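(* Suppose that for some $\Omega_X,\Omega_Y>0$, $\sup_{x_1,x_2\in X}V_X(x_1,x_2)\le\Omega_X^2$ and $\sup_{y_1,y_2\in Y}V_Y(y_1,y_2)\le\Omega_Y^2$. Let $D_X:=\Omega_X\sqrt{2/\alpha_X}$ and $D_Y:=\Omega_Y\sqrt{2/\alpha_Y}$. If in the accelerated primal-dual (APD) algorithm described in the context the parameters are set to $$\beta_t=\frac{t+1}{2},\quad\theta_t=\frac{t-1}{t},\quad\eta_t=\frac{\alpha_Xt}{2L_G+tL_KD_Y/D_X},\quad\tau_t=\frac{\alpha_YD_Y}{L_KD_X},$$ then for all $t\ge2$ the iterates $z_t^{ag}=(x_t^{ag},y_t^{ag})$ satisfy $$g(z_t^{ag})\le\frac{2L_GD_X^2}{t(t-1)}+\frac{2L_KD_XD_Y}{t}.$$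
   Context: Setting. $\mathcal X,\mathcal Y$ are finite-dimensional real vector spaces, each equipped with an inner product $\langle\cdot,\cdot\rangle$ and a norm $\|\cdot\|$, with dual norm $\|\cdot\|_*$; $X\subseteq\mathcal X$, $Y\subseteq\mathcal Y$ are closed convex sets and $Z=X\times Y$. $G$ is a smooth convex function with $G(y)-G(x)-\langle\nabla G(x),y-x\rangle\le\frac{L_G}{2}\|y-x\|^2$ for all $x,y\in X$, for some $L_G\ge0$. $K:\mathcal X\to\mathcal Y$ is linear with transpose $K^T$ and induced norm $L_K=\|K\|$ (so $\|Kx\|_*\le L_K\|x\|$ and $\langle Kx,y\rangle\le L_K\|x\|\|y\|$); $L_K>0$ so that the stepsizes are well defined. $J:Y\to\mathbb R$ is proper, convex and lower semicontinuous. The saddle point problem is $\min_{x\in X}\max_{y\in Y}G(x)+\langle Kx,y\rangle-J(y)$. Bregman divergences: $V_X(x,u)=d_X(x)-d_X(u)-\langle\nabla d_X(u),x-u\rangle$ and $V_Y(y,v)=d_Y(y)-d_Y(v)-\langle\nabla d_Y(v),y-v\rangle$, where $d_X$, $d_Y$ are strongly convex (differentiable) functions with strong convexity parameters $\alpha_X,\alpha_Y>0$ with respect to the given norms. APD algorithm. Choose $x_1\in X$, $y_1\in Y$; set $x_1^{ag}=x_1$, $y_1^{ag}=y_1$, $\bar x_1=x_1$. For $t=1,2,\dots$: $x_t^{md}=(1-\beta_t^{-1})x_t^{ag}+\beta_t^{-1}x_t$; $y_{t+1}=\operatorname{argmin}_{y\in Y}\langle-K\bar x_t,y\rangle+J(y)+\frac1{\tau_t}V_Y(y,y_t)$;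 $x_{t+1}=\operatorname{argmin}_{x\in X}\langle\nabla G(x_t^{md}),x\rangle+\langle x,K^Ty_{t+1}\rangle+\frac1{\eta_t}V_X(x,x_t)$; $x_{t+1}^{ag}=(1-\beta_t^{-1})x_t^{ag}+\beta_t^{-1}x_{t+1}$; $y_{t+1}^{ag}=(1-\beta_t^{-1})y_t^{ag}+\beta_t^{-1}y_{t+1}$; $\bar x_{t+1}=\theta_{t+1}(x_{t+1}-x_t)+x_{t+1}$. Gap function. For $\tilde z=(\tilde x,\tilde y)$, $z=(x,y)\in Z$: $Q(\tilde z,z)=[G(\tilde x)+\langle K\tilde x,y\rangle-J(y)]-[G(x)+\langle Kx,\tilde y\rangle-J(\tilde y)]$, and $g(\tilde z)=\max_{z\in Z}Q(\tilde z,z)$ (understood as a supremum). *)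

theory Defs
  imports "HOL-Analysis.Analysis"
begin

text \<open>
  The two spaces are types of class \<^class>\<open>euclidean_space\<close>, which supplies the inner product.
  The norms of the problem need not be induced by it, so they are separate functions.
\<close>

definition is_norm :: "('a::real_vector \<Rightarrow> real) \<Rightarrow> bool" where
  "is_norm N \<longleftrightarrow>
     (\<forall>x. N x \<ge> 0) \<and> (\<forall>x. N x = 0 \<longleftrightarrow> x = 0) \<and>
     (\<forall>c x. N (c *\<^sub>R x) = \<bar>c\<bar> * N x) \<and> (\<forall>x y. N (x + y) \<le> N x + N y)"

text \<open>
  In finite dimension all norms are equivalent, so the real suprema in the next two definitions
  range over nonempty bounded sets whenever \<open>N\<close> and \<open>M\<close> are norms and \<open>K\<close> is linear.
\<close>

definition dual_norm :: "('a::euclidean_space \<Rightarrow> real) \<Rightarrow> 'a \<Rightarrow> real" where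
  "dual_norm N s = (SUP v\<in>{v. N v \<le> 1}. s \<bullet> v)"

definition induced_norm ::
  "('a::euclidean_space \<Rightarrow> real) \<Rightarrow> ('b::euclidean_space \<Rightarrow> real) \<Rightarrow> ('a \<Rightarrow> 'b) \<Rightarrow> real" where
  "induced_norm N M K = (SUP x\<in>{x. N x \<le> 1}. dual_norm M (K x))"

text \<open>
  Differentiability is relative to \<open>S\<close>: functions are only required to be defined on \<open>S\<close>.
  A function differentiable on a neighbourhood of \<open>S\<close>, with its usual gradient, is a special case.
\<close>

definition gradient_on :: "'a::euclidean_space set \<Rightarrow> ('a \<Rightarrow> real) \<Rightarrow> ('a \<Rightarrow> 'a) \<Rightarrow> bool" where
  "gradient_on S f f' \<longleftrightarrow> (\<forall>x\<in>S. (f has_derivative (\<lambda>h. f' x \<bullet> h)) (at x within S))"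

definition strongly_convex_on ::
  "'a::real_vector set \<Rightarrow> ('a \<Rightarrow> real) \<Rightarrow> real \<Rightarrow> ('a \<Rightarrow> real) \<Rightarrow> bool" where
  "strongly_convex_on S N \<alpha> f \<longleftrightarrow> convex S \<and>
     (\<forall>x\<in>S. \<forall>y\<in>S. \<forall>u\<in>{0..1}.
        f ((1 - u) *\<^sub>R x + u *\<^sub>R y)
          \<le> (1 - u) * f x + u * f y - \<alpha> / 2 * u * (1 - u) * (N (x - y))\<^sup>2)"

definition lsc_on :: "'a::topological_space set \<Rightarrow> ('a \<Rightarrow> real) \<Rightarrow> bool" where
  "lsc_on S f \<longleftrightarrow> (\<forall>x\<in>S. \<forall>c<f x. \<forall>\<^sub>F y in at x within S. c < f y)"

definition bregman :: "('a::real_inner \<Rightarrow> real) \<Rightarrow> ('a \<Rightarrow> 'a) \<Rightarrow> 'a \<Rightarrow> 'a \<Rightarrow> real" where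
  "bregman d d' x u = d x - d u - d' u \<bullet> (x - u)"

text \<open>
  Sequences start at index 1; their values at 0 are irrelevant. The argmin steps say that the
  iterate is a minimizer; strong convexity makes it the only one.
\<close>

definition apd_iterates ::
  "'a::euclidean_space set \<Rightarrow> 'b::euclidean_space set \<Rightarrow> ('a \<Rightarrow> 'a) \<Rightarrow> ('a \<Rightarrow> 'b) \<Rightarrow> ('b \<Rightarrow> real) \<Rightarrow>
   ('a \<Rightarrow> 'a \<Rightarrow> real) \<Rightarrow> ('b \<Rightarrow> 'b \<Rightarrow> real) \<Rightarrow>
   (nat \<Rightarrow> real) \<Rightarrow> (nat \<Rightarrow> real) \<Rightarrow> (nat \<Rightarrow> real) \<Rightarrow> (nat \<Rightarrow> real) \<Rightarrow>
   (nat \<Rightarrow> 'a) \<Rightarrow> (nat \<Rightarrow> 'b) \<Rightarrow> (nat \<Rightarrow> 'a) \<Rightarrow> (nat \<Rightarrow> 'b) \<Rightarrow> (nat \<Rightarrow> 'a) \<Rightarrow> (nat \<Rightarrow> 'a) \<Rightarrow> bool" where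
  "apd_iterates X Y G' K J VX VY \<beta> \<theta> \<eta> \<tau> x y xag yag xmd xbar \<longleftrightarrow>
     x 1 \<in> X \<and> y 1 \<in> Y \<and> xag 1 = x 1 \<and> yag 1 = y 1 \<and> xbar 1 = x 1 \<and>
     (\<forall>t\<ge>1.
        xmd t = (1 - 1 / \<beta> t) *\<^sub>R xag t + (1 / \<beta> t) *\<^sub>R x t \<and>
        is_arg_min (\<lambda>v. (- K (xbar t)) \<bullet> v + J v + 1 / \<tau> t * VY v (y t)) (\<lambda>v. v \<in> Y) (y (t + 1)) \<and>
        is_arg_min (\<lambda>u. G' (xmd t) \<bullet> u + u \<bullet> adjoint K (y (t + 1)) + 1 / \<eta> t * VX u (x t))
          (\<lambda>u. u \<in> X) (x (t + 1)) \<and>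
        xag (t + 1) = (1 - 1 / \<beta> t) *\<^sub>R xag t + (1 / \<beta> t) *\<^sub>R x (t + 1) \<and>
        yag (t + 1) = (1 - 1 / \<beta> t) *\<^sub>R yag t + (1 / \<beta> t) *\<^sub>R y (t + 1) \<and>
        xbar (t + 1) = \<theta> (t + 1) *\<^sub>R (x (t + 1) - x t) + x (t + 1))"

definition gap_Q ::
  "('a::real_inner \<Rightarrow> real) \<Rightarrow> ('a \<Rightarrow> 'b::real_inner) \<Rightarrow> ('b \<Rightarrow> real) \<Rightarrow> 'a \<times> 'b \<Rightarrow> 'a \<times> 'b \<Rightarrow> real" where
  "gap_Q G K J = (\<lambda>(x', y') (x, y). (G x' + K x' \<bullet> y - J y) - (G x + K x \<bullet> y' - J y'))"

text \<open>The supremum is taken in the extended reals, so finiteness of the gap is not presupposed.\<close>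

definition gap ::
  "'a::real_inner set \<Rightarrow> 'b::real_inner set \<Rightarrow> ('a \<Rightarrow> real) \<Rightarrow> ('a \<Rightarrow> 'b) \<Rightarrow> ('b \<Rightarrow> real) \<Rightarrow>
   'a \<times> 'b \<Rightarrow> ereal" where
  "gap X Y G K J z' = (SUP z\<in>X \<times> Y. ereal (gap_Q G K J z' z))"

end

theory Submission
  imports Defs
begin

text \<open>
  Fix a comparison point \<open>z = (w, v)\<close> of \<open>X \<times> Y\<close>. One iteration satisfies a recursion for
  \<open>\<beta> k * Q(z\<^sub>k\<^sub>+\<^sub>1, z) - (\<beta> k - 1) * Q(z\<^sub>k, z)\<close>, where \<open>Q\<close> is evaluated at the aggregated iterates
  (\<open>apd_gap_recursion\<close>). It combines three facts: the accelerated gradient inequality for \<open>G\<close>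
  (\<open>accelerated_gradient_step\<close>), the optimality of both proximal steps in three-point form
  (\<open>bregman_prox_three_point\<close>), and convexity of \<open>J\<close> at the aggregated dual point. What
  couples the two spaces is then the single term
  \<open>K (xbar k - x (k + 1)) \<bullet> (y (k + 1) - v)\<close>.

  Multiplying step \<open>k\<close> by \<open>k\<close> makes everything telescope: \<open>k * \<beta> k = (k + 1) * (\<beta> (k + 1) - 1)\<close>,
  and \<open>k * \<theta> k = k - 1\<close> turns the extrapolation in \<open>xbar\<close> into a difference of consecutive
  values of \<open>k * P k\<close> with \<open>P k = K (x (k + 1) - x k) \<bullet> (y (k + 1) - v)\<close>, up to the error
  \<open>(k - 1) * (K (x k - x (k - 1)) \<bullet> (y (k + 1) - y k))\<close>. Young's inequality with weight
  \<open>c = DY / DX\<close> splits this error into squared step lengths, which are paid for by the Bregman terms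
  \<open>V (x (k + 1)) (x k)\<close> and \<open>V (y (k + 1)) (y k)\<close> of the proximal inequalities through strong
  convexity; the step sizes are chosen so that this payment suffices. The weights
  \<open>A k = k / \<eta> k\<close> and \<open>B k = k / \<tau> k\<close> of the remaining divergences \<open>V w (x k)\<close> and \<open>V v (y k)\<close>
  are nondecreasing, so these sum by parts to at most \<open>A k * \<Omega>X\<^sup>2 + B k * \<Omega>Y\<^sup>2\<close>.

  The outcome is the invariant \<open>potential\<close> in the final proof. There the last coupling term is
  absorbed in the same way, into the quadratic term and the dual divergence, and division by
  \<open>k * (k + 1) / 2\<close> gives the bound, uniformly in \<open>z\<close>.
\<close>

section \<open>The induced norm bounds the bilinear coupling\<close>

lemma is_norm_diff_commute:
  assumes "is_norm N"
  shows "N (u - v) = N (v - u)"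
proof -
  have "N ((-1) *\<^sub>R (v - u)) = \<bar>-1\<bar> * N (v - u)"
    using assms unfolding is_norm_def by blast
  then show ?thesis by simp
qed

text \<open>
  A norm is convex, hence continuous in finite dimension, so it has a positive minimum on the
  Euclidean unit sphere; homogeneity does the rest.
\<close>

lemma is_norm_dominates_norm:
  fixes N :: "'a::euclidean_space \<Rightarrow> real"
  assumes "is_norm N"
  obtains C where "C > 0" "\<And>v. norm v \<le> C * N v"
proof -
  have sc: "N (c *\<^sub>R v) = \<bar>c\<bar> * N v" and nn: "N v \<ge> 0" and z: "N v = 0 \<longleftrightarrow> v = 0"
    and tri: "N (v + w) \<le> N v + N w" for c v w
    using assms unfolding is_norm_def by blast+
  have "convex_on UNIV N"
  proof (rule convex_onI)
    fix t and x y :: 'a assume "0 < t" "t < (1::real)"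
    then show "N ((1 - t) *\<^sub>R x + t *\<^sub>R y) \<le> (1 - t) * N x + t * N y"
      using tri[of "(1 - t) *\<^sub>R x" "t *\<^sub>R y"] by (simp add: sc)
  qed simp
  then have cont: "continuous_on UNIV N"
    by (intro convex_on_continuous) auto
  have "sphere (0::'a) 1 \<noteq> {}" by simp
  then obtain w where w: "norm w = 1" and min: "\<And>v. norm v = 1 \<Longrightarrow> N w \<le> N v"
    using continuous_attains_inf[of "sphere (0::'a) 1" N] continuous_on_subset[OF cont] by auto
  have pos: "N w > 0" using w nn[of w] z[of w] by fastforce
  have "norm v \<le> (1 / N w) * N v" for v
  proof (cases "v = 0")
    case False
    then have "N w \<le> N ((1 / norm v) *\<^sub>R v)" by (intro min) simp
    then show ?thesis using pos False by (simp add: sc field_simps)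
  qed (simp add: nn)
  then show thesis using pos by (intro that[of "1 / N w"]) auto
qed

text \<open>
  On unit vectors this is immediate from the two suprema, and scaling gives the general case. The
  work is to show that both suprema are of sets bounded above, as a real supremum is
  uninformative otherwise; \<open>is_norm_dominates_norm\<close> reduces this to the Euclidean bounds.
\<close>

lemma inner_le_induced_norm:
  fixes K :: "'a::euclidean_space \<Rightarrow> 'b::euclidean_space"
  assumes NX: "is_norm NX" and NY: "is_norm NY" and K: "linear K"
  shows "K u \<bullet> v \<le> induced_norm NX NY K * NX u * NY v"
proof -
  have scX: "NX (c *\<^sub>R w) = \<bar>c\<bar> * NX w" and nnX: "NX w \<ge> 0" and zX: "NX w = 0 \<longleftrightarrow> w = 0" for c w
    using NX unfolding is_norm_def by blast+
  have scY: "NY (c *\<^sub>R w) = \<bar>c\<bar> * NY w" and nnY: "NY w \<ge> 0" and zY: "NY w = 0 \<longleftrightarrow> w = 0" for c w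
    using NY unfolding is_norm_def by blast+
  obtain C where C: "C > 0" "\<And>v. norm v \<le> C * NX v" using is_norm_dominates_norm[OF NX] by blast
  obtain D where D: "D > 0" "\<And>v. norm v \<le> D * NY v" using is_norm_dominates_norm[OF NY] by blast
  obtain B where B: "B > 0" "\<And>x. norm (K x) \<le> norm x * B"
    using bounded_linear.pos_bounded K by (auto simp: linear_conv_bounded_linear)
  have pair: "s \<bullet> w \<le> norm s * D" if "NY w \<le> 1" for s w
  proof -
    have "norm w \<le> D" using D(2)[of w] mult_left_le[OF that less_imp_le[OF D(1)]] by linarith
    then show ?thesis
      using norm_cauchy_schwarz[of s w] mult_left_mono[OF \<open>norm w \<le> D\<close> norm_ge_zero[of s]] by linarith
  qed
  have in_dual: "s \<bullet> w \<le> dual_norm NY s" if "NY w \<le> 1" for s w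
    unfolding dual_norm_def using that pair
    by (intro cSUP_upper bdd_aboveI2[where M = "norm s * D"]) auto
  have dual_le: "dual_norm NY s \<le> norm s * D" for s
    unfolding dual_norm_def using pair zY[of 0] by (intro cSUP_least) (auto intro: exI[of _ 0])
  have in_ind: "dual_norm NY (K x) \<le> induced_norm NX NY K" if "NX x \<le> 1" for x
    unfolding induced_norm_def
  proof (intro cSUP_upper bdd_aboveI2[where M = "C * B * D"])
    fix x' assume "x' \<in> {x. NX x \<le> 1}"
    then have "norm x' \<le> C" using C(2)[of x'] mult_left_le[OF _ less_imp_le[OF C(1)], of "NX x'"] by auto
    then have "norm (K x') \<le> C * B"
      using B(2)[of x'] mult_right_mono[OF _ less_imp_le[OF B(1)], of "norm x'" C] by linarith
    then show "dual_norm NY (K x') \<le> C * B * D"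
      using dual_le[of "K x'"] mult_right_mono[OF _ less_imp_le[OF D(1)], of "norm (K x')" "C * B"]
      by linarith
  qed (use that in simp)
  show ?thesis
  proof (cases "u = 0 \<or> v = 0")
    case True
    then show ?thesis using linear_0[OF K] zX[of 0] zY[of 0] by auto
  next
    case False
    then have pos: "NX u > 0" "NY v > 0" using nnX[of u] nnY[of v] zX[of u] zY[of v] by fastforce+
    let ?u = "(1 / NX u) *\<^sub>R u" and ?v = "(1 / NY v) *\<^sub>R v"
    have "K ?u \<bullet> ?v \<le> induced_norm NX NY K"
      using in_dual[of ?v "K ?u"] in_ind[of ?u] pos by (simp add: scX scY)
    then show ?thesis using pos by (simp add: linear_scale[OF K] field_simps)
  qed
qed

section \<open>First-order inequalities from one-sided derivatives\<close>

text \<open>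
  Gradients are relative to \<open>S\<close>, whose boundary may matter and whose interior may be empty. The
  only derivatives that enter the argument are therefore the one-sided ones along segments in \<open>S\<close>.
\<close>

lemma gradient_on_segment_limit:
  fixes f :: "'a::euclidean_space \<Rightarrow> real"
  assumes "gradient_on S f f'" "convex S" "p \<in> S" "q \<in> S"
  shows "((\<lambda>s. (f ((1 - s) *\<^sub>R p + s *\<^sub>R q) - f p) / s) \<longlongrightarrow> f' p \<bullet> (q - p)) (at_right 0)"
proof -
  let ?g = "\<lambda>s::real. (1 - s) *\<^sub>R p + s *\<^sub>R q"
  have g: "(?g has_derivative (\<lambda>h. h *\<^sub>R (q - p))) (at 0 within {0..1})"
    by (auto intro!: derivative_eq_intros simp: algebra_simps)
  have sub: "?g ` {0..1} \<subseteq> S"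
    using assms(2-4) by (auto simp: convex_alt)
  have "(f has_derivative (\<lambda>h. f' p \<bullet> h)) (at (?g 0) within ?g ` {0..1})"
    using assms(1,3) sub by (auto simp: gradient_on_def intro: has_derivative_subset)
  from has_derivative_in_compose[OF g this]
  have "((\<lambda>s. f (?g s)) has_field_derivative (f' p \<bullet> (q - p))) (at 0 within {0..1})"
    by (simp add: has_field_derivative_def mult.commute[of _ "f' p \<bullet> (q - p)"])
  then have "((\<lambda>s. (f (?g s) - f p) / s) \<longlongrightarrow> f' p \<bullet> (q - p)) (at 0 within {0..1})"
    by (simp add: has_field_derivative_iff)
  then show ?thesis by (simp add: at_within_Icc_at_right)
qed

text \<open>
  Strong convexity bounds the difference quotient at \<open>p\<close> towards \<open>q\<close> with step \<open>s\<close> by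
  \<open>f q - f p - \<alpha> / 2 * (1 - s) * (N (q - p))\<^sup>2\<close>; let \<open>s\<close> tend to 0.
\<close>

lemma strongly_convex_on_gradient_le:
  fixes f :: "'a::euclidean_space \<Rightarrow> real"
  assumes f: "strongly_convex_on S N \<alpha> f" and "gradient_on S f f'" and N: "is_norm N"
    and p: "p \<in> S" and q: "q \<in> S"
  shows "\<alpha> / 2 * (N (q - p))\<^sup>2 \<le> bregman f f' q p"
proof -
  have "convex S" using f by (simp add: strongly_convex_on_def)
  note lim = gradient_on_segment_limit[OF assms(2) this p q]
  have up: "((\<lambda>s. f q - f p - \<alpha> / 2 * (1 - s) * (N (q - p))\<^sup>2) \<longlongrightarrow>
       f q - f p - \<alpha> / 2 * (1 - 0) * (N (q - p))\<^sup>2) (at_right 0)"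
    by (intro tendsto_intros)
  have "\<forall>\<^sub>F s in at_right (0::real). s \<in> {0<..<1}"
    by (rule eventually_at_right_real) simp
  then have "\<forall>\<^sub>F s in at_right 0. (f ((1 - s) *\<^sub>R p + s *\<^sub>R q) - f p) / s
      \<le> f q - f p - \<alpha> / 2 * (1 - s) * (N (q - p))\<^sup>2"
  proof eventually_elim
    case (elim s)
    then have "f ((1 - s) *\<^sub>R p + s *\<^sub>R q)
        \<le> (1 - s) * f p + s * f q - \<alpha> / 2 * s * (1 - s) * (N (p - q))\<^sup>2"
      using f p q by (simp add: strongly_convex_on_def)
    then have "f ((1 - s) *\<^sub>R p + s *\<^sub>R q) - f p
        \<le> (f q - f p - \<alpha> / 2 * (1 - s) * (N (q - p))\<^sup>2) * s"
      by (simp add: is_norm_diff_commute[OF N, of p q] algebra_simps)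
    then show ?case using elim by (simp add: divide_le_eq)
  qed
  from tendsto_le[OF _ up lim this] show ?thesis
    by (simp add: bregman_def)
qed

lemma convex_on_gradient_le:
  fixes f :: "'a::euclidean_space \<Rightarrow> real"
  assumes "convex_on S f" "gradient_on S f f'" "p \<in> S" "q \<in> S"
  shows "f p + f' p \<bullet> (q - p) \<le> f q"
proof -
  have "is_norm (norm :: 'a \<Rightarrow> real)" by (auto simp: is_norm_def norm_triangle_ineq)
  moreover have "strongly_convex_on S norm 0 f"
    using assms(1) convex_onD[OF assms(1)] by (auto simp: strongly_convex_on_def convex_on_def)
  ultimately show ?thesis
    using strongly_convex_on_gradient_le[of S norm 0 f f' p q] assms by (simp add: bregman_def)
qed

text \<open>
  Comparing the minimizer \<open>p\<close> with points of the segment towards \<open>q\<close>, and using convexity for \<open>h\<close>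
  but the derivative for the divergence, gives the variational inequality
  \<open>h p - h q \<le> c * ((d' p - d' u) \<bullet> (q - p))\<close>. Its right-hand side is the stated combination of
  divergences by the three-point identity.
\<close>

lemma bregman_prox_three_point:
  fixes h d :: "'a::euclidean_space \<Rightarrow> real"
  assumes h: "convex_on S h" and d: "gradient_on S d d'"
    and min: "is_arg_min (\<lambda>v. h v + c * bregman d d' v u) (\<lambda>v. v \<in> S) p" and q: "q \<in> S"
  shows "h p - h q \<le> c * (bregman d d' q u - bregman d d' q p - bregman d d' p u)"
proof -
  have p: "p \<in> S" and le: "\<And>v. v \<in> S \<Longrightarrow> h p + c * bregman d d' p u \<le> h v + c * bregman d d' v u"
    using min by (auto simp: is_arg_min_linorder)
  have S: "convex S" using h by (simp add: convex_on_def)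
  let ?g = "\<lambda>s. (1 - s) *\<^sub>R p + s *\<^sub>R q"
  have "((\<lambda>s. h q - h p + c * ((d (?g s) - d p) / s - d' u \<bullet> (q - p))) \<longlongrightarrow>
      h q - h p + c * (d' p \<bullet> (q - p) - d' u \<bullet> (q - p))) (at_right 0)"
    by (intro tendsto_intros gradient_on_segment_limit[OF d S p q])
  moreover have "\<forall>\<^sub>F s in at_right (0::real). s \<in> {0<..<1}"
    by (rule eventually_at_right_real) simp
  then have "\<forall>\<^sub>F s in at_right 0. 0 \<le> h q - h p + c * ((d (?g s) - d p) / s - d' u \<bullet> (q - p))"
  proof eventually_elim
    case (elim s)
    then have gS: "?g s \<in> S" using S p q by (auto simp: convex_alt)
    have hg: "h (?g s) \<le> (1 - s) * h p + s * h q"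
      using convex_onD[OF h, of s p q] p q elim by auto
    have "bregman d d' (?g s) u - bregman d d' p u = d (?g s) - d p - s * (d' u \<bullet> (q - p))"
      by (simp add: bregman_def algebra_simps)
    then have "c * (d (?g s) - d p - s * (d' u \<bullet> (q - p))) =
       c * bregman d d' (?g s) u - c * bregman d d' p u" by (metis right_diff_distrib)
    then have "0 \<le> s * (h q - h p) + c * (d (?g s) - d p - s * (d' u \<bullet> (q - p)))"
      using le[OF gS] hg by (simp add: algebra_simps)
    also have "\<dots> = s * (h q - h p + c * ((d (?g s) - d p) / s - d' u \<bullet> (q - p)))"
      using elim by (simp add: field_simps)
    finally show ?case using elim by (simp add: zero_le_mult_iff)
  qed
  ultimately have "0 \<le> h q - h p + c * (d' p \<bullet> (q - p) - d' u \<bullet> (q - p))"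
    by (intro tendsto_lowerbound) auto
  also have "d' p \<bullet> (q - p) - d' u \<bullet> (q - p) =
      bregman d d' q u - bregman d d' q p - bregman d d' p u"
    by (simp add: bregman_def algebra_simps)
  finally show ?thesis by simp
qed

section \<open>One iteration\<close>

text \<open>
  The point \<open>ag' - md\<close> is \<open>(x' - x) / b\<close>, so \<open>b\<close> times the quadratic smoothness error
  costs only \<open>LG / (2 * b)\<close>: this is the source of acceleration. The linear term is distributed over
  \<open>b *\<^sub>R (ag' - md) = (b - 1) *\<^sub>R (ag - md) + (w - md) + (x' - w)\<close>; convexity at \<open>md\<close> turns the first
  two pieces into function values and leaves the third for the proximal inequality.
\<close>

lemma accelerated_gradient_step:
  fixes G :: "'a::euclidean_space \<Rightarrow> real"
  assumes NX: "is_norm NX" and G: "convex_on X G" "gradient_on X G G'"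
    and smooth: "\<And>u v. u \<in> X \<Longrightarrow> v \<in> X \<Longrightarrow> G v - G u - G' u \<bullet> (v - u) \<le> LG / 2 * (NX (v - u))\<^sup>2"
    and b: "b \<ge> 1"
    and mem: "ag \<in> X" "x \<in> X" "x' \<in> X" "w \<in> X"
    and md: "md = (1 - 1 / b) *\<^sub>R ag + (1 / b) *\<^sub>R x"
    and ag': "ag' = (1 - 1 / b) *\<^sub>R ag + (1 / b) *\<^sub>R x'"
  shows "b * G ag' \<le> (b - 1) * G ag + G w + G' md \<bullet> (x' - w) + LG / (2 * b) * (NX (x' - x))\<^sup>2"
proof -
  have X: "convex X" using G(1) by (simp add: convex_on_def)
  have mdX: "md \<in> X" and agX: "ag' \<in> X"
    unfolding md ag' using X mem b by (auto simp: convex_alt)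
  have diff: "ag' - md = (1 / b) *\<^sub>R (x' - x)" unfolding md ag' by (simp add: algebra_simps)
  have "NX (ag' - md) = NX (x' - x) / b"
    using NX b unfolding diff by (simp add: is_norm_def)
  then have "G ag' \<le> G md + G' md \<bullet> (ag' - md) + LG / 2 * (NX (x' - x) / b)\<^sup>2"
    using smooth[OF mdX agX] by simp
  then have "b * G ag' \<le> b * (G md + G' md \<bullet> (ag' - md) + LG / 2 * (NX (x' - x) / b)\<^sup>2)"
    using b by (intro mult_left_mono) auto
  also have "\<dots> = b * G md + G' md \<bullet> (b *\<^sub>R (ag' - md)) + LG / (2 * b) * (NX (x' - x))\<^sup>2"
  proof -
    have "b * (LG / 2 * (NX (x' - x) / b)\<^sup>2) = LG / (2 * b) * (NX (x' - x))\<^sup>2"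
      using b by (simp add: field_simps power2_eq_square)
    then show ?thesis by (simp add: distrib_left)
  qed
  also have "b *\<^sub>R (ag' - md) = (b - 1) *\<^sub>R (ag - md) + (w - md) + (x' - w)"
  proof -
    have "b *\<^sub>R ag' = (b - 1) *\<^sub>R ag + x'" unfolding ag' using b
      by (simp add: scaleR_right_distrib right_diff_distrib)
    then show ?thesis by (simp add: algebra_simps)
  qed
  finally have 1: "b * G ag' \<le> (b - 1) * (G md + G' md \<bullet> (ag - md)) + (G md + G' md \<bullet> (w - md))
      + G' md \<bullet> (x' - w) + LG / (2 * b) * (NX (x' - x))\<^sup>2"
    by (simp add: inner_add_right algebra_simps)
  have 2: "(b - 1) * (G md + G' md \<bullet> (ag - md)) \<le> (b - 1) * G ag"
    using convex_on_gradient_le[OF G mdX mem(1)] b by (intro mult_left_mono) auto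
  show ?thesis using 1 2 convex_on_gradient_le[OF G mdX mem(4)] by linarith
qed

text \<open>
  After the proximal inequalities at \<open>x'\<close> (against \<open>w\<close>) and \<open>y'\<close> (against \<open>v\<close>) are added, the
  bilinear terms of the gap and those of the two subproblems collapse to
  \<open>K (xb - x') \<bullet> (y' - v)\<close>, which would vanish if \<open>x'\<close> were already known when \<open>y'\<close> is computed.
\<close>

lemma apd_gap_recursion:
  fixes G :: "'a::euclidean_space \<Rightarrow> real" and J :: "'b::euclidean_space \<Rightarrow> real"
  assumes NX: "is_norm NX" and G: "convex_on X G" "gradient_on X G G'"
    and smooth: "\<And>u v. u \<in> X \<Longrightarrow> v \<in> X \<Longrightarrow> G v - G u - G' u \<bullet> (v - u) \<le> LG / 2 * (NX (v - u))\<^sup>2"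
    and K: "linear K" and J: "convex_on Y J"
    and dX: "gradient_on X dX dX'" and dY: "gradient_on Y dY dY'"
    and b: "b \<ge> 1"
    and mem: "ax \<in> X" "x \<in> X" "w \<in> X" "ay \<in> Y" "v \<in> Y"
    and md: "md = (1 - 1 / b) *\<^sub>R ax + (1 / b) *\<^sub>R x"
    and y': "is_arg_min (\<lambda>v. (- K xb) \<bullet> v + J v + cy * bregman dY dY' v y) (\<lambda>v. v \<in> Y) y'"
    and x': "is_arg_min (\<lambda>u. G' md \<bullet> u + u \<bullet> adjoint K y' + cx * bregman dX dX' u x) (\<lambda>u. u \<in> X) x'"
    and ax': "ax' = (1 - 1 / b) *\<^sub>R ax + (1 / b) *\<^sub>R x'"
    and ay': "ay' = (1 - 1 / b) *\<^sub>R ay + (1 / b) *\<^sub>R y'"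
  shows "b * gap_Q G K J (ax', ay') (w, v) \<le> (b - 1) * gap_Q G K J (ax, ay) (w, v)
      + K (xb - x') \<bullet> (y' - v)
      + cx * (bregman dX dX' w x - bregman dX dX' w x' - bregman dX dX' x' x)
      + cy * (bregman dY dY' v y - bregman dY dY' v y' - bregman dY dY' y' y)
      + LG / (2 * b) * (NX (x' - x))\<^sup>2"
proof -
  have X: "convex X" and Y: "convex Y" using G(1) J by (simp_all add: convex_on_def)
  have x'X: "x' \<in> X" and y'Y: "y' \<in> Y" using x' y' by (auto simp: is_arg_min_def)
  have "convex_on Y (\<lambda>v. (- K xb) \<bullet> v)"
    using Y by (auto simp: convex_on_alt inner_add_right)
  then have "convex_on Y (\<lambda>v. (- K xb) \<bullet> v + J v)" using J by (rule convex_on_add)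
  from bregman_prox_three_point[OF this dY y' mem(5)]
  have ystep: "J y' - J v \<le> K xb \<bullet> (y' - v)
      + cy * (bregman dY dY' v y - bregman dY dY' v y' - bregman dY dY' y' y)"
    by (simp add: inner_diff_right)
  have "convex_on X (\<lambda>u. G' md \<bullet> u + u \<bullet> adjoint K y')"
    using X by (auto simp: convex_on_alt inner_add_right inner_add_left algebra_simps)
  from bregman_prox_three_point[OF this dX x' mem(3)]
  have xstep: "G' md \<bullet> (x' - w) \<le> K w \<bullet> y' - K x' \<bullet> y'
      + cx * (bregman dX dX' w x - bregman dX dX' w x' - bregman dX dX' x' x)"
    by (simp add: adjoint_works[OF K] inner_diff_right)
  note gstep = accelerated_gradient_step[OF NX G smooth b mem(1,2) x'X mem(3) md ax']
  have "J ay' \<le> (1 - 1 / b) * J ay + (1 / b) * J y'"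
    unfolding ay' using convex_onD[OF J, of "1 / b" ay y'] mem(4) y'Y b by auto
  then have "b * J ay' \<le> b * ((1 - 1 / b) * J ay + (1 / b) * J y')"
    using b by (intro mult_left_mono) auto
  then have jstep: "b * J ay' \<le> (b - 1) * J ay + J y'"
    using b by (simp add: algebra_simps)
  have "b *\<^sub>R ax' = (b - 1) *\<^sub>R ax + x'" "b *\<^sub>R ay' = (b - 1) *\<^sub>R ay + y'"
    unfolding ax' ay' using b by (simp_all add: scaleR_right_distrib right_diff_distrib)
  then have "K (b *\<^sub>R ax') \<bullet> v = K ((b - 1) *\<^sub>R ax + x') \<bullet> v"
    "K w \<bullet> (b *\<^sub>R ay') = K w \<bullet> ((b - 1) *\<^sub>R ay + y')" by simp_all
  then have kx: "b * (K ax' \<bullet> v) = (b - 1) * (K ax \<bullet> v) + K x' \<bullet> v"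
    and ky: "b * (K w \<bullet> ay') = (b - 1) * (K w \<bullet> ay) + K w \<bullet> y'"
    by (simp_all add: linear_add[OF K] linear_scale[OF K] inner_add_left inner_add_right)
  have "b * gap_Q G K J (ax', ay') (w, v)
      = b * G ax' + b * (K ax' \<bullet> v) - b * J v - b * G w - b * (K w \<bullet> ay') + b * J ay'"
    by (simp add: gap_Q_def algebra_simps)
  moreover have "(b - 1) * gap_Q G K J (ax, ay) (w, v)
      = (b - 1) * G ax + (b - 1) * (K ax \<bullet> v) - (b - 1) * J v - (b - 1) * G w
        - (b - 1) * (K w \<bullet> ay) + (b - 1) * J ay"
    by (simp add: gap_Q_def algebra_simps)
  moreover have "K (xb - x') \<bullet> (y' - v) = K xb \<bullet> (y' - v) - K x' \<bullet> y' + K x' \<bullet> v"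
    by (simp add: linear_diff[OF K] inner_diff_left inner_diff_right)
  moreover have "b * J v = (b - 1) * J v + J v" "b * G w = (b - 1) * G w + G w"
    by (simp_all add: algebra_simps)
  ultimately show ?thesis
    using ystep xstep gstep jstep kx ky by linarith
qed

section \<open>Telescoping\<close>

lemma weighted_young:
  fixes a b c :: real
  assumes "c > 0"
  shows "a * b \<le> c / 2 * a\<^sup>2 + b\<^sup>2 / (2 * c)"
proof -
  have "0 \<le> (c * a - b)\<^sup>2 / (2 * c)" using assms by simp
  also have "\<dots> = c / 2 * a\<^sup>2 + b\<^sup>2 / (2 * c) - a * b"
    using assms by (simp add: field_simps power2_eq_square)
  finally show ?thesis by simp
qed

theorem corollary2p2:
  fixes X :: "'a::euclidean_space set" and Y :: "'b::euclidean_space set"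
    and NX :: "'a \<Rightarrow> real" and NY :: "'b \<Rightarrow> real"
    and G :: "'a \<Rightarrow> real" and G' :: "'a \<Rightarrow> 'a" and J :: "'b \<Rightarrow> real" and K :: "'a \<Rightarrow> 'b"
    and dX :: "'a \<Rightarrow> real" and dX' :: "'a \<Rightarrow> 'a" and dY :: "'b \<Rightarrow> real" and dY' :: "'b \<Rightarrow> 'b"
    and LG LK \<alpha>X \<alpha>Y \<Omega>X \<Omega>Y DX DY :: real
    and \<beta> \<theta> \<eta> \<tau> :: "nat \<Rightarrow> real"
    and x xag xmd xbar :: "nat \<Rightarrow> 'a" and y yag :: "nat \<Rightarrow> 'b" and t :: nat
  assumes "is_norm NX" and "is_norm NY"
    and "closed X" and "convex X" and "closed Y" and "convex Y"
    and "convex_on X G" and "gradient_on X G G'" and "LG \<ge> 0"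
    and "\<And>u v. u \<in> X \<Longrightarrow> v \<in> X \<Longrightarrow> G v - G u - G' u \<bullet> (v - u) \<le> LG / 2 * (NX (v - u))\<^sup>2"
    and "linear K" and "LK = induced_norm NX NY K" and "LK > 0"
    and "convex_on Y J" and "lsc_on Y J"
    and "gradient_on X dX dX'" and "\<alpha>X > 0" and "strongly_convex_on X NX \<alpha>X dX"
    and "gradient_on Y dY dY'" and "\<alpha>Y > 0" and "strongly_convex_on Y NY \<alpha>Y dY"
    and "\<Omega>X > 0" and "(SUP (x1, x2)\<in>X \<times> X. ereal (bregman dX dX' x1 x2)) \<le> ereal (\<Omega>X\<^sup>2)"
    and "\<Omega>Y > 0" and "(SUP (y1, y2)\<in>Y \<times> Y. ereal (bregman dY dY' y1 y2)) \<le> ereal (\<Omega>Y\<^sup>2)"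
    and "DX = \<Omega>X * sqrt (2 / \<alpha>X)" and "DY = \<Omega>Y * sqrt (2 / \<alpha>Y)"
    and "\<And>k. k \<ge> 1 \<Longrightarrow> \<beta> k = (real k + 1) / 2"
    and "\<And>k. k \<ge> 1 \<Longrightarrow> \<theta> k = (real k - 1) / real k"
    and "\<And>k. k \<ge> 1 \<Longrightarrow> \<eta> k = \<alpha>X * real k / (2 * LG + real k * LK * DY / DX)"
    and "\<And>k. k \<ge> 1 \<Longrightarrow> \<tau> k = \<alpha>Y * DY / (LK * DX)"
    and "apd_iterates X Y G' K J (bregman dX dX') (bregman dY dY') \<beta> \<theta> \<eta> \<tau> x y xag yag xmd xbar"
    and "t \<ge> 2"
  shows "gap X Y G K J (xag t, yag t)
    \<le> ereal (2 * LG * DX\<^sup>2 / (real t * (real t - 1)) + 2 * LK * DX * DY / real t)"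
proof -
  note NX = assms(1) and NY = assms(2) and X = assms(4) and Y = assms(6)
    and G = assms(7,8) and LG = assms(9) and smooth = assms(10)
    and K = assms(11) and LK = assms(12,13) and J = assms(14)
    and dX = assms(16) and aX = assms(17) and scX = assms(18)
    and dY = assms(19) and aY = assms(20) and scY = assms(21)
    and OX = assms(22,23) and OY = assms(24,25) and DX = assms(26) and DY = assms(27)
    and params = assms(28-31) and apd = assms(32) and t = assms(33)
  let ?VX = "bregman dX dX'" and ?VY = "bregman dY dY'"
  have DXpos: "DX > 0" and DYpos: "DY > 0" using OX(1) OY(1) aX aY DX DY by simp_all
  have DX2: "\<Omega>X\<^sup>2 = \<alpha>X / 2 * DX\<^sup>2" and DY2: "\<Omega>Y\<^sup>2 = \<alpha>Y / 2 * DY\<^sup>2"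
    using aX aY by (simp_all add: DX DY power_mult_distrib)
  \<comment> \<open>This weight balances the final terms \<open>LK * c * DX\<^sup>2 / 2\<close> and \<open>LK * DY\<^sup>2 / (2 * c)\<close>.\<close>
  define c where "c = DY / DX"
  have c: "c > 0" using DXpos DYpos by (simp add: c_def)
  define A where "A k = (2 * LG + real k * LK * c) / \<alpha>X" for k
  define B where "B k = real k * LK / (\<alpha>Y * c)" for k
  have A0: "A k \<ge> 0" and B0: "B k \<ge> 0" for k
    using aX aY LG LK(2) c by (simp_all add: A_def B_def)

  have start: "x 1 \<in> X" "y 1 \<in> Y" "xag 1 = x 1" "yag 1 = y 1" "xbar 1 = x 1"
    using apd by (simp_all add: apd_iterates_def)
  have md: "xmd k = (1 - 1 / \<beta> k) *\<^sub>R xag k + (1 / \<beta> k) *\<^sub>R x k"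
    and ymin: "is_arg_min (\<lambda>v. (- K (xbar k)) \<bullet> v + J v + 1 / \<tau> k * ?VY v (y k)) (\<lambda>v. v \<in> Y) (y (k + 1))"
    and xmin: "is_arg_min (\<lambda>u. G' (xmd k) \<bullet> u + u \<bullet> adjoint K (y (k + 1)) + 1 / \<eta> k * ?VX u (x k))
          (\<lambda>u. u \<in> X) (x (k + 1))"
    and xag: "xag (k + 1) = (1 - 1 / \<beta> k) *\<^sub>R xag k + (1 / \<beta> k) *\<^sub>R x (k + 1)"
    and yag: "yag (k + 1) = (1 - 1 / \<beta> k) *\<^sub>R yag k + (1 / \<beta> k) *\<^sub>R y (k + 1)"
    and xbar: "xbar (k + 1) = \<theta> (k + 1) *\<^sub>R (x (k + 1) - x k) + x (k + 1)"
    if "k \<ge> 1" for k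
    using apd that unfolding apd_iterates_def by blast+
  have b1: "\<beta> k \<ge> 1" if "k \<ge> 1" for k using params(1)[OF that] that by simp
  have xX: "x (k + 1) \<in> X" and yY: "y (k + 1) \<in> Y" for k
    using start(1,2) xmin[of k] ymin[of k] by (cases k; auto simp: is_arg_min_def)+
  have agX: "xag (k + 1) \<in> X" and agY: "yag (k + 1) \<in> Y" for k
  proof (induction k)
    case 0
    { case 1 show ?case using start by simp }
    { case 2 show ?case using start by simp }
  next
    case (Suc k)
    have b: "0 \<le> 1 / \<beta> (k + 1)" "1 / \<beta> (k + 1) \<le> 1" using b1[of "k + 1"] by auto
    { case 1 show ?case using xag[of "k + 1"] X Suc(1) xX[of "k + 1"] b by (auto simp: convex_alt) }
    { case 2 show ?case using yag[of "k + 1"] Y Suc(2) yY[of "k + 1"] b by (auto simp: convex_alt) }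
  qed
  \<comment> \<open>At \<open>k = 0\<close> the value \<open>x 0\<close> is arbitrary, but its coefficient \<open>\<theta> 1\<close> is 0. The induction below can therefore start at 0.\<close>
  have xbar': "xbar (k + 1) = \<theta> (k + 1) *\<^sub>R (x (k + 1) - x k) + x (k + 1)" for k
    using xbar[of k] start(5) params(2)[of 1] by (cases k) auto

  have VX_le: "?VX u w \<le> \<Omega>X\<^sup>2" if "u \<in> X" "w \<in> X" for u w
    using OX(2) that by (auto simp: SUP_le_iff)
  have VY_le: "?VY u w \<le> \<Omega>Y\<^sup>2" if "u \<in> Y" "w \<in> Y" for u w
    using OY(2) that by (auto simp: SUP_le_iff)
  have VX_ge: "\<alpha>X / 2 * (NX (u - w))\<^sup>2 \<le> ?VX u w" if "u \<in> X" "w \<in> X" for u w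
    using strongly_convex_on_gradient_le[OF scX dX NX] that by blast
  have VY_ge: "\<alpha>Y / 2 * (NY (u - w))\<^sup>2 \<le> ?VY u w" if "u \<in> Y" "w \<in> Y" for u w
    using strongly_convex_on_gradient_le[OF scY dY NY] that by blast
  have pair: "K u \<bullet> v \<le> LK * (c / 2 * (NX u)\<^sup>2 + (NY v)\<^sup>2 / (2 * c))" for u v
  proof -
    have "K u \<bullet> v \<le> LK * (NX u * NY v)"
      using inner_le_induced_norm[OF NX NY K, of u v] LK(1) by (simp add: mult.assoc)
    also have "\<dots> \<le> LK * (c / 2 * (NX u)\<^sup>2 + (NY v)\<^sup>2 / (2 * c))"
      using weighted_young[OF c] LK(2) by (intro mult_left_mono) auto
    finally show ?thesis .
  qed

  have bound: "gap_Q G K J (xag t, yag t) (w, v)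
      \<le> 2 * LG * DX\<^sup>2 / (real t * (real t - 1)) + 2 * LK * DX * DY / real t"
    if w: "w \<in> X" and v: "v \<in> Y" for w v
  proof -
    define Q where "Q k = gap_Q G K J (xag (k + 1), yag (k + 1)) (w, v)" for k
    define P where "P k = K (x (k + 1) - x k) \<bullet> (y (k + 1) - v)" for k
    define a where "a k = (NX (x (k + 1) - x k))\<^sup>2" for k
    have potential: "real k * (real k + 1) / 2 * Q k + real k * P k + real k * LK * c / 2 * a k
        + A k * ?VX w (x (k + 1)) + B k * ?VY v (y (k + 1)) \<le> A k * \<Omega>X\<^sup>2 + B k * \<Omega>Y\<^sup>2" for k
    proof (induction k)
      case 0
      have "A 0 * ?VX w (x 1) \<le> A 0 * \<Omega>X\<^sup>2"
        using VX_le[OF w start(1)] A0 by (intro mult_left_mono) auto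
      then show ?case by (simp add: B_def)
    next
      case (Suc k)
      define s where "s = real k + 1"
      have s: "s > 0" "real (k + 1) = s" "real k = s - 1" by (simp_all add: s_def)
      have k1: "k + 1 \<ge> 1" by simp
      define Vx where "Vx j = ?VX w (x (k + j))" for j
      define Vy where "Vy j = ?VY v (y (k + j))" for j
      define vx where "vx = ?VX (x (k + 2)) (x (k + 1))"
      define vy where "vy = ?VY (y (k + 2)) (y (k + 1))"
      define b where "b = (NY (y (k + 2) - y (k + 1)))\<^sup>2"
      have beta: "\<beta> (k + 1) = (s + 1) / 2" using params(1)[OF k1] s by simp
      have "K (xbar (k + 1) - x (k + 2)) \<bullet> (y (k + 2) - v)
        = \<theta> (k + 1) * (K (x (k + 1) - x k) \<bullet> (y (k + 2) - v)) - P (k + 1)"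
        unfolding xbar' P_def
        by (simp add: linear_diff[OF K] linear_add[OF K] linear_scale[OF K] algebra_simps)
      also have "K (x (k + 1) - x k) \<bullet> (y (k + 2) - v)
        = P k + K (x (k + 1) - x k) \<bullet> (y (k + 2) - y (k + 1))"
        unfolding P_def by (simp add: inner_diff_right)
      finally have coupling: "K (xbar (k + 1) - x (k + 2)) \<bullet> (y (k + 2) - v)
        = \<theta> (k + 1) * (P k + K (x (k + 1) - x k) \<bullet> (y (k + 2) - y (k + 1))) - P (k + 1)" .
      have rec: "\<beta> (k + 1) * Q (k + 1) \<le> (\<beta> (k + 1) - 1) * Q k
          + (\<theta> (k + 1) * (P k + K (x (k + 1) - x k) \<bullet> (y (k + 2) - y (k + 1))) - P (k + 1))
          + 1 / \<eta> (k + 1) * (Vx 1 - Vx 2 - vx) + 1 / \<tau> (k + 1) * (Vy 1 - Vy 2 - vy)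
          + LG / (2 * \<beta> (k + 1)) * a (k + 1)"
        using apd_gap_recursion[OF NX G smooth K J dX dY b1[OF k1] agX[of k] xX[of k] w agY[of k] v
            md[OF k1] ymin[OF k1] xmin[OF k1] xag[OF k1] yag[OF k1]] coupling
        unfolding Q_def Vx_def Vy_def vx_def vy_def a_def by (simp add: numeral_2_eq_2)
      \<comment> \<open>With \<open>k + 1\<close> as the multiplier, the step sizes become the weights \<open>A\<close> and \<open>B\<close>.\<close>
      have eta: "s * (1 / \<eta> (k + 1)) = A (k + 1)"
        using params(3)[OF k1] s aX by (simp add: A_def c_def field_simps)
      have tau: "s * (1 / \<tau> (k + 1)) = B (k + 1)"
        using params(4)[OF k1] s by (simp add: B_def c_def field_simps)
      have theta: "s * \<theta> (k + 1) = s - 1"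
        using params(2)[OF k1] s by simp
      have "s * (\<beta> (k + 1) * Q (k + 1)) \<le> s * ((\<beta> (k + 1) - 1) * Q k
          + (\<theta> (k + 1) * (P k + K (x (k + 1) - x k) \<bullet> (y (k + 2) - y (k + 1))) - P (k + 1))
          + 1 / \<eta> (k + 1) * (Vx 1 - Vx 2 - vx) + 1 / \<tau> (k + 1) * (Vy 1 - Vy 2 - vy)
          + LG / (2 * \<beta> (k + 1)) * a (k + 1))"
        using rec s(1) by (intro mult_left_mono) auto
      also have "\<dots> = s * (\<beta> (k + 1) - 1) * Q k
          + (s * \<theta> (k + 1)) * (P k + K (x (k + 1) - x k) \<bullet> (y (k + 2) - y (k + 1))) - s * P (k + 1)
          + (s * (1 / \<eta> (k + 1))) * (Vx 1 - Vx 2 - vx) + (s * (1 / \<tau> (k + 1))) * (Vy 1 - Vy 2 - vy)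
          + s * (LG / (2 * \<beta> (k + 1))) * a (k + 1)"
        by (simp add: algebra_simps)
      also have "\<dots> = s * (\<beta> (k + 1) - 1) * Q k
          + (s - 1) * (P k + K (x (k + 1) - x k) \<bullet> (y (k + 2) - y (k + 1))) - s * P (k + 1)
          + A (k + 1) * (Vx 1 - Vx 2 - vx) + B (k + 1) * (Vy 1 - Vy 2 - vy)
          + s * (LG / (2 * \<beta> (k + 1))) * a (k + 1)"
        unfolding eta tau theta ..
      finally have scaled': "s * (\<beta> (k + 1) * Q (k + 1)) \<le> \<dots>" .
      have scaled: "s * (s + 1) / 2 * Q (k + 1) \<le> (s - 1) * s / 2 * Q k
          + (s - 1) * P k + (s - 1) * (K (x (k + 1) - x k) \<bullet> (y (k + 2) - y (k + 1))) - s * P (k + 1)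
          + A (k + 1) * (Vx 1 - Vx 2 - vx) + B (k + 1) * (Vy 1 - Vy 2 - vy)
          + s * (LG / (s + 1)) * a (k + 1)"
      proof -
        have "s * ((s + 1) / 2 - 1) = (s - 1) * s / 2" "2 * ((s + 1) / 2) = s + 1"
          by (simp_all add: field_simps)
        then show ?thesis
          using scaled' unfolding beta by (simp only: distrib_left mult.assoc[symmetric] times_divide_eq_right)
      qed
      have cross: "(s - 1) * (K (x (k + 1) - x k) \<bullet> (y (k + 2) - y (k + 1)))
          \<le> (s - 1) * LK * c / 2 * a k + s * LK / (2 * c) * b"
      proof -
        have "(s - 1) * (K (x (k + 1) - x k) \<bullet> (y (k + 2) - y (k + 1)))
            \<le> (s - 1) * (LK * (c / 2 * a k + b / (2 * c)))"
          using pair s unfolding a_def b_def by (intro mult_left_mono) auto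
        also have "\<dots> = (s - 1) * LK * c / 2 * a k + (s - 1) * (LK / (2 * c) * b)"
          by (simp add: algebra_simps)
        also have "(s - 1) * (LK / (2 * c) * b) \<le> s * (LK / (2 * c) * b)"
          using c LK(2) by (intro mult_right_mono) (auto simp: b_def)
        finally show ?thesis by simp
      qed
      \<comment> \<open>The proximal terms pay for the squared steps. Of the primal payment, \<open>LG\<close> covers the smoothness error and the rest stays in the invariant to absorb the next coupling error.\<close>
      have xdrop: "(LG + s * LK * c / 2) * a (k + 1) \<le> A (k + 1) * vx"
      proof -
        have "A (k + 1) * (\<alpha>X / 2 * a (k + 1)) \<le> A (k + 1) * vx"
          using VX_ge[OF xX[of "k + 1"] xX[of k]] A0
          by (intro mult_left_mono) (auto simp: a_def vx_def numeral_2_eq_2)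
        moreover have "A (k + 1) * (\<alpha>X / 2 * a (k + 1)) = (LG + s * LK * c / 2) * a (k + 1)"
          using aX s by (simp add: A_def field_simps)
        ultimately show ?thesis by linarith
      qed
      have ydrop: "s * LK / (2 * c) * b \<le> B (k + 1) * vy"
      proof -
        have "B (k + 1) * (\<alpha>Y / 2 * b) \<le> B (k + 1) * vy"
          using VY_ge[OF yY[of "k + 1"] yY[of k]] B0
          by (intro mult_left_mono) (auto simp: b_def vy_def numeral_2_eq_2)
        moreover have "B (k + 1) * (\<alpha>Y / 2 * b) = s * LK / (2 * c) * b"
          using aY s c by (simp add: B_def field_simps)
        ultimately show ?thesis by linarith
      qed
      have gdrop: "s * (LG / (s + 1)) * a (k + 1) \<le> LG * a (k + 1)"
        using s LG by (intro mult_right_mono) (auto simp: a_def field_simps)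
      \<comment> \<open>Summation by parts: the weights grow, and the growth multiplies a divergence bounded by the diameter.\<close>
      have "(A (k + 1) - A k) * Vx 1 \<le> (A (k + 1) - A k) * \<Omega>X\<^sup>2"
        using VX_le[OF w xX[of k]] aX LK(2) c unfolding Vx_def
        by (intro mult_left_mono) (auto simp: A_def divide_right_mono)
      moreover have "(B (k + 1) - B k) * Vy 1 \<le> (B (k + 1) - B k) * \<Omega>Y\<^sup>2"
        using VY_le[OF v yY[of k]] aY LK(2) c unfolding Vy_def
        by (intro mult_left_mono) (auto simp: B_def divide_right_mono)
      moreover have "(s - 1) * s / 2 * Q k + (s - 1) * P k + (s - 1) * LK * c / 2 * a k
        + A k * Vx 1 + B k * Vy 1 \<le> A k * \<Omega>X\<^sup>2 + B k * \<Omega>Y\<^sup>2"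
        using Suc.IH by (simp add: s Vx_def Vy_def)
      ultimately have "s * (s + 1) / 2 * Q (k + 1) + s * P (k + 1) + s * LK * c / 2 * a (k + 1)
        + A (k + 1) * Vx 2 + B (k + 1) * Vy 2 \<le> A (k + 1) * \<Omega>X\<^sup>2 + B (k + 1) * \<Omega>Y\<^sup>2"
        using scaled cross xdrop ydrop gdrop
        unfolding left_diff_distrib[of "A (k + 1)"] left_diff_distrib[of "B (k + 1)"]
          right_diff_distrib[of "A (k + 1)"] right_diff_distrib[of "B (k + 1)"]
          distrib_right[of LG]
        by linarith
      then show ?case unfolding Vx_def Vy_def s_def by (simp add: numeral_2_eq_2 add.commute)
    qed
    define k where "k = t - 1"
    have k: "k \<ge> 1" "t = k + 1" using t by (auto simp: k_def)
    \<comment> \<open>The coupling term of the last step is absorbed by the two nonnegative terms next to it in the invariant.\<close>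
    have "- P k \<le> LK * (c / 2 * a k + (NY (v - y (k + 1)))\<^sup>2 / (2 * c))"
    proof -
      have "NX (x k - x (k + 1)) = NX (x (k + 1) - x k)"
        "NY (y (k + 1) - v) = NY (v - y (k + 1))"
        using is_norm_diff_commute NX NY by blast+
      then show ?thesis using pair[of "x k - x (k + 1)" "y (k + 1) - v"]
        by (simp add: P_def a_def linear_diff[OF K] inner_diff_left)
    qed
    then have "real k * - P k \<le> real k * (LK * (c / 2 * a k + (NY (v - y (k + 1)))\<^sup>2 / (2 * c)))"
      by (intro mult_left_mono) auto
    also have "\<dots> = real k * LK * c / 2 * a k + B k * (\<alpha>Y / 2 * (NY (v - y (k + 1)))\<^sup>2)"
      using aY c by (simp add: B_def field_simps)
    also have "\<dots> \<le> real k * LK * c / 2 * a k + B k * ?VY v (y (k + 1))"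
      using VY_ge[OF v yY[of k]] B0 by (intro add_left_mono mult_left_mono) auto
    finally have last: "real k * - P k \<le> real k * LK * c / 2 * a k + B k * ?VY v (y (k + 1))" .
    have "0 \<le> \<alpha>X / 2 * (NX (w - x (k + 1)))\<^sup>2" using aX by simp
    then have "0 \<le> A k * ?VX w (x (k + 1))"
      using VX_ge[OF w xX[of k]] A0 by (intro mult_nonneg_nonneg) auto
    then have "real k * (real k + 1) / 2 * Q k \<le> A k * \<Omega>X\<^sup>2 + B k * \<Omega>Y\<^sup>2"
      using potential[of k] last by simp
    also have "A k * \<Omega>X\<^sup>2 + B k * \<Omega>Y\<^sup>2 = LG * DX\<^sup>2 + real k * LK * DX * DY"
      using aX aY DXpos DYpos unfolding DX2 DY2 A_def B_def c_def
      by (simp add: field_simps power2_eq_square)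
    also have "\<dots> = real k * (real k + 1) / 2 *
        (2 * LG * DX\<^sup>2 / (real t * (real t - 1)) + 2 * LK * DX * DY / real t)"
      using k by (simp add: divide_simps) (simp add: algebra_simps)
    finally have "Q k \<le> 2 * LG * DX\<^sup>2 / (real t * (real t - 1)) + 2 * LK * DX * DY / real t"
      using k(1) by (subst (asm) mult_le_cancel_left_pos) auto
    then show ?thesis by (simp add: Q_def k(2))
  qed
  show ?thesis
    unfolding gap_def using bound by (auto intro!: SUP_least)
qed

end
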